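(* Let $A$ be a regular canonical subalgebra of an AF C*-algebra $B$. Then $A$ is a principal ideal algebra; that is, for every norm closed two-sided ideal $I$ of $A$ there is an element $g\in A$ such that $I$ is the smallest norm closed two-sided ideal of $A$ containing $g$.
   Context: An AF (approximately finite dimensional) C*-algebra is a C*-algebra $B=\overline{\bigcup_{n\ge1}B_n}$, the closure of an increasing union of finite-dimensional C*-subalgebras $B_n\cong\bigoplus_{m=1}^{l(n)}M_{k(n,m)}$. A matrix unit system for the chain $\{B_n\}$ is a family $\{e_{ij}^{(nm)}: n\ge 1,\ 1\le m\le l(n),\ 1\le i,j\le k(n,m)\}$ such that for each $n$ the elements $e_{ij}^{(nm)}$ form a system of matrix units (a basis) for $B_n$, and each matrix unit of $B_n$ is a sum of matrix units of $B_{n+1}$. The regular canonical masa associated with this system is the abelian C*-subalgebra $D=\overline{\bigcup_n D_n}$ of $B$, where $D_n\subseteq B_n$ is the span of the diagonal matrix units $e_{ii}^{(nm)}$ of $B_n$; equivalently $D$ is the C*-algebra generated by all diagonal matrix units. A regular canonical subalgebra of $B$ is a norm closed subalgebra $A$ of $B$ with $D\subseteq A\subseteq B$, where $D$ is a regular canonical masa associated with some matrix unit system for $B$. Ideals are norm closed and two-sided; an ideal is principal if it is generated (as a norm closed two-sided ideal) by a single element of the algebra, and an algebra is a principal ideal algebra if all its ideals are principal. *)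

theory Defs
  imports "HOL-Analysis.Analysis"
begin

text \<open>C*-algebras, not assumed to be unital. The class \<^class>\<open>real_normed_algebra\<close> supplies
  submultiplicativity of the norm and \<^class>\<open>banach\<close> supplies completeness.\<close>

class cstar_algebra = real_normed_algebra + banach +
  fixes scaleC :: "complex \<Rightarrow> 'a \<Rightarrow> 'a" (infixr "*\<^sub>C" 75)
    and star :: "'a \<Rightarrow> 'a"
  assumes scaleC_add_right: "c *\<^sub>C (x + y) = c *\<^sub>C x + c *\<^sub>C y"
    and scaleC_add_left: "(c + d) *\<^sub>C x = c *\<^sub>C x + d *\<^sub>C x"
    and scaleC_scaleC: "c *\<^sub>C (d *\<^sub>C x) = (c * d) *\<^sub>C x"
    and scaleC_of_real: "complex_of_real r *\<^sub>C x = r *\<^sub>R x"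
    and norm_scaleC: "norm (c *\<^sub>C x) = cmod c * norm x"
    and mult_scaleC_left: "(c *\<^sub>C x) * y = c *\<^sub>C (x * y)"
    and mult_scaleC_right: "x * (c *\<^sub>C y) = c *\<^sub>C (x * y)"
    and star_star: "star (star x) = x"
    and star_add: "star (x + y) = star x + star y"
    and star_scaleC: "star (c *\<^sub>C x) = cnj c *\<^sub>C star x"
    and star_mult: "star (x * y) = star y * star x"
    and cstar_identity: "norm (star x * x) = (norm x)\<^sup>2"

global_interpretation complex_vector: vector_space
  "scaleC :: complex \<Rightarrow> 'a \<Rightarrow> 'a::cstar_algebra"
  defines csubspace = complex_vector.subspace
    and cspan = complex_vector.span
    and cdependent = complex_vector.dependent
proof
  show "1 *\<^sub>C x = x" for x :: 'a
    using scaleC_of_real[of 1 x] by simp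
qed (simp_all add: scaleC_add_right scaleC_add_left scaleC_scaleC)

definition csubalgebra :: "'a::cstar_algebra set \<Rightarrow> bool" where
  "csubalgebra A \<longleftrightarrow> csubspace A \<and> (\<forall>x\<in>A. \<forall>y\<in>A. x * y \<in> A)"

definition cstar_subalgebra :: "'a::cstar_algebra set \<Rightarrow> bool" where
  "cstar_subalgebra A \<longleftrightarrow> csubalgebra A \<and> closed A \<and> (\<forall>x\<in>A. star x \<in> A)"

definition finite_cdim :: "'a::cstar_algebra set \<Rightarrow> bool" where
  "finite_cdim S \<longleftrightarrow> (\<exists>F. finite F \<and> cspan F = S)"

text \<open>Algebras are carrier sets inside an ambient C*-algebra, so an abstract \<open>B\<close> is covered
  by \<open>B = UNIV\<close>. Chains are indexed from \<open>0\<close> rather than \<open>1\<close>.\<close>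

definition AF_chain :: "(nat \<Rightarrow> 'a::cstar_algebra set) \<Rightarrow> 'a set \<Rightarrow> bool" where
  "AF_chain Bs B \<longleftrightarrow>
     (\<forall>n. cstar_subalgebra (Bs n) \<and> finite_cdim (Bs n)) \<and>
     (\<forall>n. Bs n \<subseteq> Bs (Suc n)) \<and>
     B = closure (\<Union>n. Bs n)"

definition AF_algebra :: "'a::cstar_algebra set \<Rightarrow> bool" where
  "AF_algebra B \<longleftrightarrow> (\<exists>Bs. AF_chain Bs B)"

text \<open>At level \<open>n\<close> there are \<open>l n\<close> summands, the \<open>m\<close>-th being a full matrix algebra of size
  \<open>k n m\<close>, and \<open>e n m i j\<close> is its \<open>(i, j)\<close> matrix unit. The case \<open>l n = 0\<close> (a zero algebra)
  is allowed.\<close>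

definition unit_index :: "(nat \<Rightarrow> nat) \<Rightarrow> (nat \<Rightarrow> nat \<Rightarrow> nat) \<Rightarrow> nat \<Rightarrow> (nat \<times> nat \<times> nat) set" where
  "unit_index l k n = {(m, i, j). m \<in> {1..l n} \<and> i \<in> {1..k n m} \<and> j \<in> {1..k n m}}"

definition matrix_units ::
  "(nat \<Rightarrow> nat) \<Rightarrow> (nat \<Rightarrow> nat \<Rightarrow> nat) \<Rightarrow> (nat \<Rightarrow> nat \<Rightarrow> nat \<Rightarrow> nat \<Rightarrow> 'a::cstar_algebra) \<Rightarrow> nat \<Rightarrow> 'a set"
  where
  "matrix_units l k e n = (\<lambda>(m, i, j). e n m i j) ` unit_index l k n"

definition matrix_unit_system ::
  "(nat \<Rightarrow> 'a::cstar_algebra set) \<Rightarrow> (nat \<Rightarrow> nat) \<Rightarrow> (nat \<Rightarrow> nat \<Rightarrow> nat) \<Rightarrow>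
     (nat \<Rightarrow> nat \<Rightarrow> nat \<Rightarrow> nat \<Rightarrow> 'a) \<Rightarrow> bool" where
  "matrix_unit_system Bs l k e \<longleftrightarrow>
     (\<forall>n. \<forall>m\<in>{1..l n}. 1 \<le> k n m) \<and>
     (\<forall>n. \<forall>(m, i, j)\<in>unit_index l k n. \<forall>(m', i', j')\<in>unit_index l k n.
        e n m i j * e n m' i' j' = (if m = m' \<and> j = i' then e n m i j' else 0)) \<and>
     (\<forall>n. \<forall>(m, i, j)\<in>unit_index l k n. star (e n m i j) = e n m j i) \<and>
     (\<forall>n. inj_on (\<lambda>(m, i, j). e n m i j) (unit_index l k n) \<and>
        \<not> cdependent (matrix_units l k e n) \<and>
        cspan (matrix_units l k e n) = Bs n) \<and>
     (\<forall>n. \<forall>x\<in>matrix_units l k e n. \<exists>S\<subseteq>matrix_units l k e (Suc n). x = \<Sum>S)"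

definition canonical_masa ::
  "(nat \<Rightarrow> nat) \<Rightarrow> (nat \<Rightarrow> nat \<Rightarrow> nat) \<Rightarrow> (nat \<Rightarrow> nat \<Rightarrow> nat \<Rightarrow> nat \<Rightarrow> 'a::cstar_algebra) \<Rightarrow> 'a set"
  where
  "canonical_masa l k e =
     closure (\<Union>n. cspan {e n m i i | m i. m \<in> {1..l n} \<and> i \<in> {1..k n m}})"

definition regular_canonical_masa :: "'a::cstar_algebra set \<Rightarrow> 'a set \<Rightarrow> bool" where
  "regular_canonical_masa D B \<longleftrightarrow>
     (\<exists>Bs l k e. AF_chain Bs B \<and> matrix_unit_system Bs l k e \<and> D = canonical_masa l k e)"

definition regular_canonical_subalgebra :: "'a::cstar_algebra set \<Rightarrow> 'a set \<Rightarrow> bool" where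
  "regular_canonical_subalgebra A B \<longleftrightarrow>
     csubalgebra A \<and> closed A \<and> A \<subseteq> B \<and> (\<exists>D. regular_canonical_masa D B \<and> D \<subseteq> A)"

definition closed_ideal :: "'a::cstar_algebra set \<Rightarrow> 'a set \<Rightarrow> bool" where
  "closed_ideal I A \<longleftrightarrow>
     I \<subseteq> A \<and> csubspace I \<and> closed I \<and> (\<forall>a\<in>A. \<forall>x\<in>I. a * x \<in> I \<and> x * a \<in> I)"

definition principal_closed_ideal :: "'a::cstar_algebra set \<Rightarrow> 'a set \<Rightarrow> bool" where
  "principal_closed_ideal I A \<longleftrightarrow>
     closed_ideal I A \<and> (\<exists>g\<in>A. g \<in> I \<and> (\<forall>J. closed_ideal J A \<and> g \<in> J \<longrightarrow> I \<subseteq> J))"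

definition principal_ideal_algebra :: "'a::cstar_algebra set \<Rightarrow> bool" where
  "principal_ideal_algebra A \<longleftrightarrow> (\<forall>I. closed_ideal I A \<longrightarrow> principal_closed_ideal I A)"

end

theory Submission
  imports Defs
begin

text \<open>Every closed ideal \<open>I\<close> of \<open>A\<close> is a closed bimodule over the diagonal \<open>D\<close>. The
  proof shows that closed \<open>D\<close>-bimodules are generated by one element, in two steps.

  A closed \<open>D\<close>-bimodule \<open>I\<close> is determined by the matrix units it contains
  (\<open>mem_closure_span_units\<close>). Let \<open>x \<in> I\<close> be close to some \<open>b\<^sub>0 \<in> B\<^sub>n\<close>, and much closer to some
  \<open>b \<in> B\<^sub>N\<close> with \<open>N \<ge> n\<close>. Take the minimal ones among the
  projections of \<open>D\<^sub>N\<close> that commute with \<open>B\<^sub>n\<close> and lie below its unit, and pinch by them: this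
  is a contraction that fixes \<open>b\<^sub>0\<close>, so the pinched \<open>b\<close> is still close to \<open>x\<close>; and the only units
  of level \<open>N\<close> that survive in it are the subunits of the units of level \<open>n\<close>. A surviving unit
  outside \<open>I\<close> has a small coefficient, because a matrix unit at distance less than \<open>1\<close> from \<open>I\<close> lies
  in \<open>I\<close> (\<open>near_unit_mem\<close>). Subunits of one unit have orthogonal ranges and orthogonal sources, so
  a combination of them has norm at most the largest coefficient; hence dropping the units outside
  \<open>I\<close> costs at most the number of units of the fixed level \<open>n\<close> times the distance from \<open>x\<close> to \<open>b\<close>,
  however large \<open>N\<close> is.

  The units in \<open>I\<close> form a countable family, any two of which either are nested or have no common
  subunit (\<open>subunit_laminar\<close>). A series of all the maximal ones, with positive weights that make it converge,
  is then an element \<open>g\<close> of \<open>I\<close> without overlaps. For a maximal unit \<open>w\<close>, compress \<open>g\<close> to the corners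
  cut out by the level \<open>N\<close> subunits of \<open>w\<close>: up to level \<open>N\<close> every summand of \<open>g\<close> other than \<open>w\<close>
  vanishes, and the remaining tail is small, so in the limit a positive multiple of \<open>w\<close> is left.
  Every closed ideal containing \<open>g\<close> thus contains all maximal units of \<open>I\<close>, therefore all units of
  \<open>I\<close>, therefore \<open>I\<close> (\<open>generator_generates\<close>).\<close>

section \<open>Norms of sums of orthogonal corners\<close>

lemma scaleC_one [simp]: "1 *\<^sub>C x = x"
  by (rule complex_vector.scale_one)

lemma star_zero [simp]: "star 0 = (0 :: 'a::cstar_algebra)"
  using star_scaleC[of 0 "0::'a"] by simp

lemma star_sum: "star (sum f S) = (\<Sum>s\<in>S. star (f s :: 'a::cstar_algebra))"
  by (induction S rule: infinite_finite_induct) (simp_all add: star_add)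

definition projection :: "'a::cstar_algebra \<Rightarrow> bool" where
  "projection p \<longleftrightarrow> star p = p \<and> p * p = p"

lemma norm_projection_le:
  assumes "projection p" shows "norm (p :: 'a::cstar_algebra) \<le> 1"
proof -
  have "norm p * norm p = norm p"
    using assms cstar_identity[of p] by (simp add: projection_def power2_eq_square)
  then show ?thesis by (cases "norm p = 0") auto
qed

lemma norm_compress_le:
  assumes "projection p" "projection q"
  shows "norm (p * x * q) \<le> norm (x :: 'a::cstar_algebra)"
proof -
  have "norm (p * x * q) \<le> norm (p * x) * norm q" by (rule norm_mult_ineq)
  also have "\<dots> \<le> norm (p * x) * 1"
    by (intro mult_left_mono norm_projection_le assms) simp
  also have "\<dots> \<le> norm p * norm x" using norm_mult_ineq by simp
  also have "\<dots> \<le> 1 * norm x"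
    by (intro mult_right_mono norm_projection_le assms) simp
  finally show ?thesis by simp
qed

lemma sum_mult_sum_orthogonal:
  fixes f g :: "'i \<Rightarrow> 'a::cstar_algebra"
  assumes "finite S" "\<And>s t. s \<in> S \<Longrightarrow> t \<in> S \<Longrightarrow> s \<noteq> t \<Longrightarrow> f s * g t = 0"
  shows "sum f S * sum g S = (\<Sum>s\<in>S. f s * g s)"
proof -
  have "sum f S * sum g S = (\<Sum>s\<in>S. \<Sum>t\<in>S. f s * g t)"
    by (simp add: sum_product)
  also have "\<dots> = (\<Sum>s\<in>S. \<Sum>t\<in>S. if t = s then f s * g s else 0)"
    by (intro sum.cong refl) (use assms in auto)
  finally show ?thesis using assms(1) by (simp add: sum.delta)
qed

text \<open>Squaring preserves orthogonality and self-adjointness, and \<open>norm (sum a S)\<close> squared is the norm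
  of the sum of the squares. So each step replaces the factor \<open>card S\<close>, the cost of the
  triangle inequality at the start, by its square root.\<close>
lemma norm_sum_orthogonal_selfadjoint_power:
  fixes a :: "'i \<Rightarrow> 'a::cstar_algebra"
  assumes "finite S" "\<And>s. s \<in> S \<Longrightarrow> star (a s) = a s" "\<And>s. s \<in> S \<Longrightarrow> norm (a s) \<le> M"
    and "\<And>s t. s \<in> S \<Longrightarrow> t \<in> S \<Longrightarrow> s \<noteq> t \<Longrightarrow> a s * a t = 0" "0 \<le> M"
  shows "norm (sum a S) ^ (2 ^ j) \<le> real (card S) * M ^ (2 ^ j)"
  using assms
proof (induction j arbitrary: a M)
  case 0
  have "norm (sum a S) \<le> (\<Sum>s\<in>S. norm (a s))" by (rule norm_sum)
  also have "\<dots> \<le> (\<Sum>s\<in>S. M)" by (intro sum_mono 0)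
  finally show ?case by simp
next
  case (Suc j)
  let ?b = "\<lambda>s. a s * a s"
  have nb: "norm (?b s) \<le> M\<^sup>2" if "s \<in> S" for s
    using cstar_identity[of "a s"] Suc.prems(2,3)[OF that] by (simp add: power_mono)
  have ob: "?b s * ?b t = 0" if "s \<in> S" "t \<in> S" "s \<noteq> t" for s t
  proof -
    have "?b s * ?b t = a s * (a s * a t) * a t" by (simp add: mult.assoc)
    then show ?thesis using Suc.prems(4)[OF that] by simp
  qed
  have "norm (sum ?b S) ^ (2 ^ j) \<le> real (card S) * (M\<^sup>2) ^ (2 ^ j)"
    by (rule Suc.IH) (use Suc.prems nb ob in \<open>auto simp: star_mult\<close>)
  moreover have "sum ?b S = star (sum a S) * sum a S"
    using sum_mult_sum_orthogonal[of S a a] Suc.prems by (simp add: star_sum)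
  ultimately show ?case
    by (simp add: cstar_identity power_mult[symmetric])
qed

lemma le_if_powers_le:
  fixes x M c :: real
  assumes "\<And>j. x ^ (2 ^ j) \<le> c * M ^ (2 ^ j)" "0 \<le> M" "0 \<le> x"
  shows "x \<le> M"
proof (rule ccontr)
  assume "\<not> x \<le> M"
  then have xM: "M < x" and x0: "0 < x" using assms by auto
  have "(\<lambda>n. c * (M / x) ^ n) \<longlonglongrightarrow> c * 0"
    by (intro tendsto_mult tendsto_const LIMSEQ_power_zero) (use xM x0 assms in auto)
  then have "\<forall>\<^sub>F n in sequentially. c * (M / x) ^ n < 1"
    by (rule order_tendstoD) simp
  then obtain n0 where n0: "\<And>n. n \<ge> n0 \<Longrightarrow> c * (M / x) ^ n < 1"
    by (auto simp: eventually_sequentially)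
  have "n0 \<le> 2 ^ n0" using less_exp[of n0] by simp
  from n0[OF this] have "c * M ^ (2 ^ n0) < x ^ (2 ^ n0)"
    using x0 by (simp add: power_divide divide_simps)
  with assms(1)[of n0] show False by simp
qed

lemma norm_sum_orthogonal_selfadjoint:
  fixes a :: "'i \<Rightarrow> 'a::cstar_algebra"
  assumes "finite S" "\<And>s. s \<in> S \<Longrightarrow> star (a s) = a s" "\<And>s. s \<in> S \<Longrightarrow> norm (a s) \<le> M"
    and "\<And>s t. s \<in> S \<Longrightarrow> t \<in> S \<Longrightarrow> s \<noteq> t \<Longrightarrow> a s * a t = 0" "0 \<le> M"
  shows "norm (sum a S) \<le> M"
  by (rule le_if_powers_le[OF norm_sum_orthogonal_selfadjoint_power[OF assms]])
     (use assms in auto)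

text \<open>For a sum \<open>y\<close> of corners with orthogonal ranges and orthogonal sources, \<open>star y * y\<close> is an
  orthogonal sum of positive elements. This one estimate bounds pinchings, compressions and
  combinations of subunits alike.\<close>
lemma norm_sum_compressions:
  fixes p q x :: "'i \<Rightarrow> 'a::cstar_algebra"
  assumes fin: "finite S" and pp: "\<And>s. s \<in> S \<Longrightarrow> projection (p s)"
    and pq: "\<And>s. s \<in> S \<Longrightarrow> projection (q s)"
    and op: "\<And>s t. s \<in> S \<Longrightarrow> t \<in> S \<Longrightarrow> s \<noteq> t \<Longrightarrow> p s * p t = 0"
    and oq: "\<And>s t. s \<in> S \<Longrightarrow> t \<in> S \<Longrightarrow> s \<noteq> t \<Longrightarrow> q s * q t = 0"
    and M: "0 \<le> M" "\<And>s. s \<in> S \<Longrightarrow> norm (x s) \<le> M"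
  shows "norm (\<Sum>s\<in>S. p s * x s * q s) \<le> M"
proof -
  define y where "y s = p s * x s * q s" for s
  have st: "star (y s) = q s * star (x s) * p s" if "s \<in> S" for s
    using pp[OF that] pq[OF that] by (simp add: y_def projection_def star_mult mult.assoc)
  have o1: "star (y s) * y t = 0" if "s \<in> S" "t \<in> S" "s \<noteq> t" for s t
  proof -
    have "star (y s) * y t = q s * star (x s) * (p s * p t) * x t * q t"
      unfolding st[OF that(1)] unfolding y_def by (simp only: mult.assoc)
    then show ?thesis using op that by simp
  qed
  have o2: "y s * star (y t) = 0" if "s \<in> S" "t \<in> S" "s \<noteq> t" for s t
  proof -
    have "y s * star (y t) = p s * x s * (q s * q t) * star (x t) * p t"
      unfolding st[OF that(2)] unfolding y_def by (simp only: mult.assoc)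
    then show ?thesis using oq that by simp
  qed
  have ny: "norm (y s) \<le> M" if "s \<in> S" for s
    using order_trans[OF norm_compress_le[OF pp pq, OF that that] M(2)[OF that]]
    unfolding y_def .
  have "(norm (sum y S))\<^sup>2 = norm (\<Sum>s\<in>S. star (y s) * y s)"
    unfolding cstar_identity[symmetric] star_sum using sum_mult_sum_orthogonal[OF fin o1] by simp
  also have "\<dots> \<le> M\<^sup>2"
  proof (rule norm_sum_orthogonal_selfadjoint[OF fin])
    fix s t assume s: "s \<in> S"
    show "star (star (y s) * y s) = star (y s) * y s" by (simp add: star_mult star_star)
    show "norm (star (y s) * y s) \<le> M\<^sup>2"
      using ny[OF s] M(1) by (simp add: cstar_identity power_mono)
    assume t: "t \<in> S" "s \<noteq> t"
    have "star (y s) * y s * (star (y t) * y t) = star (y s) * (y s * star (y t)) * y t"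
      by (simp add: mult.assoc)
    then show "star (y s) * y s * (star (y t) * y t) = 0" using o2 s t by simp
  qed simp
  finally show ?thesis unfolding y_def using M(1) by (simp add: power2_le_iff_abs_le)
qed

section \<open>Matrix units and their refinements\<close>

definition row_proj :: "'a::cstar_algebra \<Rightarrow> 'a" where "row_proj v = v * star v"
definition col_proj :: "'a::cstar_algebra \<Rightarrow> 'a" where "col_proj v = star v * v"

text \<open>For a unit \<open>t\<close> of a level above that of the unit \<open>v\<close>, this says that \<open>t\<close> occurs in the expansion
  of \<open>v\<close> as a sum of units of the level of \<open>t\<close> (lemma \<open>subunit_iff\<close> below). The description by a corner
  needs no indices and applies to every pair of levels.\<close>
definition subunit :: "'a::cstar_algebra \<Rightarrow> 'a \<Rightarrow> bool" where
  "subunit t v \<longleftrightarrow> row_proj t * v * col_proj t = t"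

locale nested_matrix_units =
  fixes Bs :: "nat \<Rightarrow> 'a::cstar_algebra set" and l :: "nat \<Rightarrow> nat" and k :: "nat \<Rightarrow> nat \<Rightarrow> nat"
    and e :: "nat \<Rightarrow> nat \<Rightarrow> nat \<Rightarrow> nat \<Rightarrow> 'a"
  assumes system: "matrix_unit_system Bs l k e"
begin

abbreviation U where "U n \<equiv> matrix_units l k e n"
abbreviation idx where "idx n \<equiv> unit_index l k n"

definition diag where "diag n = {e n m i i | m i. m \<in> {1..l n} \<and> i \<in> {1..k n m}}"

lemma e_mult:
  "(m, i, j) \<in> idx n \<Longrightarrow> (m', i', j') \<in> idx n \<Longrightarrow>
     e n m i j * e n m' i' j' = (if m = m' \<and> j = i' then e n m i j' else 0)"
  using conjunct1[OF conjunct2[OF system[unfolded matrix_unit_system_def]]] by fastforce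

lemma e_star: "(m, i, j) \<in> idx n \<Longrightarrow> star (e n m i j) = e n m j i"
  using conjunct1[OF conjunct2[OF conjunct2[OF system[unfolded matrix_unit_system_def]]]]
  by fastforce

lemma units_basis:
  "inj_on (\<lambda>(m, i, j). e n m i j) (idx n)" "\<not> cdependent (U n)" "cspan (U n) = Bs n"
  using system unfolding matrix_unit_system_def by simp_all

lemma e_inj:
  "(m, i, j) \<in> idx n \<Longrightarrow> (m', i', j') \<in> idx n \<Longrightarrow>
     e n m i j = e n m' i' j' \<longleftrightarrow> m = m' \<and> i = i' \<and> j = j'"
  using inj_on_eq_iff[OF units_basis(1), of "(m, i, j)" n "(m', i', j')"] by simp

lemmas units_independent = units_basis(2) and span_units = units_basis(3)

lemma units_refine_Suc: "v \<in> U n \<Longrightarrow> \<exists>S\<subseteq>U (Suc n). v = \<Sum>S"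
  using system unfolding matrix_unit_system_def by simp

lemma finite_units [simp]: "finite (U n)"
proof -
  have "idx n \<subseteq> {1..l n} \<times> (\<Union>m\<in>{1..l n}. {1..k n m}) \<times> (\<Union>m\<in>{1..l n}. {1..k n m})"
    unfolding unit_index_def by auto
  then have "finite (idx n)" by (rule finite_subset) simp
  then show ?thesis unfolding matrix_units_def by simp
qed

lemma unitsE:
  assumes "v \<in> U n"
  obtains m i j where "(m, i, j) \<in> idx n" "v = e n m i j"
  using assms unfolding matrix_units_def by auto

lemma unitsI: "(m, i, j) \<in> idx n \<Longrightarrow> e n m i j \<in> U n"
  unfolding matrix_units_def by force

lemma idx_simps: "(m, i, j) \<in> idx n \<Longrightarrow> (m, i, i) \<in> idx n \<and> (m, j, j) \<in> idx n \<and> (m, j, i) \<in> idx n"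
  unfolding unit_index_def by auto

lemma diag_alt: "diag n = {e n m i i | m i. (m, i, i) \<in> idx n}"
  unfolding diag_def unit_index_def by auto

lemma zero_notin_units: "0 \<notin> U n"
  using units_independent complex_vector.dependent_zero by blast

lemma row_e: "(m, i, j) \<in> idx n \<Longrightarrow> row_proj (e n m i j) = e n m i i"
  and col_e: "(m, i, j) \<in> idx n \<Longrightarrow> col_proj (e n m i j) = e n m j j"
  unfolding row_proj_def col_proj_def by (simp_all add: e_star e_mult idx_simps)

lemma row_diag: "v \<in> U n \<Longrightarrow> row_proj v \<in> diag n"
  and col_diag: "v \<in> U n \<Longrightarrow> col_proj v \<in> diag n"
  unfolding diag_alt by (elim unitsE; use row_e col_e idx_simps in blast)+

lemma star_units: "v \<in> U n \<Longrightarrow> star v \<in> U n"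
  by (elim unitsE) (simp add: e_star unitsI idx_simps)

lemma diag_units: "r \<in> diag n \<Longrightarrow> r \<in> U n"
  unfolding diag_alt by (auto intro: unitsI)

lemma diag_row: "r \<in> diag n \<Longrightarrow> row_proj r = r"
  and diag_col: "r \<in> diag n \<Longrightarrow> col_proj r = r"
  unfolding diag_alt by (auto simp: row_e col_e)

lemma diag_mult_unit: "r \<in> diag n \<Longrightarrow> v \<in> U n \<Longrightarrow> r * v = (if r = row_proj v then v else 0)"
  and unit_mult_diag: "r \<in> diag n \<Longrightarrow> v \<in> U n \<Longrightarrow> v * r = (if r = col_proj v then v else 0)"
  unfolding diag_alt by (auto elim!: unitsE simp: row_e col_e e_mult e_inj idx_simps)

lemma diag_star: "r \<in> diag n \<Longrightarrow> star r = r"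
  unfolding diag_alt by (auto simp: e_star)

lemma diag_mult: "r \<in> diag n \<Longrightarrow> s \<in> diag n \<Longrightarrow> r * s = (if r = s then r else 0)"
  using diag_mult_unit[of r n s] by (auto simp: diag_units diag_row)

lemma diag_projection: "r \<in> diag n \<Longrightarrow> projection r"
  by (simp add: projection_def diag_star diag_mult)

lemma unit_eqI:
  "v \<in> U n \<Longrightarrow> w \<in> U n \<Longrightarrow> row_proj v = row_proj w \<Longrightarrow> col_proj v = col_proj w \<Longrightarrow> v = w"
  by (elim unitsE) (simp add: row_e col_e e_inj idx_simps)

lemma unit_mult:
  assumes v: "v \<in> U n" and w: "w \<in> U n" and eq: "col_proj v = row_proj w"
  shows "v * w \<in> U n" "row_proj (v * w) = row_proj v" "col_proj (v * w) = col_proj w"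
proof -
  obtain m i j where v': "(m, i, j) \<in> idx n" "v = e n m i j" using v by (rule unitsE)
  obtain m' i' j' where w': "(m', i', j') \<in> idx n" "w = e n m' i' j'" using w by (rule unitsE)
  have "m = m'" "j = i'"
    using eq v' w' by (auto simp: row_e col_e e_inj idx_simps)
  moreover from this have "(m, i, j') \<in> idx n"
    using v' w' unfolding unit_index_def by auto
  ultimately show "v * w \<in> U n" "row_proj (v * w) = row_proj v" "col_proj (v * w) = col_proj w"
    using v' w' by (auto simp: e_mult row_e col_e intro: unitsI)
qed

lemma unit_mult_zero:
  assumes "v \<in> U n" "w \<in> U n" "col_proj v \<noteq> row_proj w"
  shows "v * w = 0"
  using assms
  by (elim unitsE) (auto simp: row_e col_e e_inj e_mult idx_simps)

lemma star_proj: "row_proj (star v) = col_proj v" "col_proj (star v) = row_proj v"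
  by (simp_all add: row_proj_def col_proj_def star_star)

lemma row_proj_mult: "v \<in> U n \<Longrightarrow> row_proj v * v = v"
  using diag_mult_unit[OF row_diag, of v n v] by simp

lemma mult_col_proj: "v \<in> U n \<Longrightarrow> v * col_proj v = v"
  using unit_mult_diag[OF col_diag, of v n v] by simp

lemma compress_unit:
  assumes "t \<in> U n" "s \<in> U n"
  shows "row_proj t * s * col_proj t = (if s = t then t else 0)"
proof -
  have r: "row_proj t * s = (if row_proj t = row_proj s then s else 0)"
    by (rule diag_mult_unit[OF row_diag]) (use assms in auto)
  have c: "s * col_proj t = (if col_proj t = col_proj s then s else 0)"
    by (rule unit_mult_diag[OF col_diag]) (use assms in auto)
  show ?thesis
  proof (cases "s = t")
    case True
    then show ?thesis using row_proj_mult[OF assms(1)] mult_col_proj[OF assms(1)] by simp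
  next
    case False
    then have "row_proj t \<noteq> row_proj s \<or> col_proj t \<noteq> col_proj s"
      using unit_eqI assms by metis
    then show ?thesis
    proof
      assume "row_proj t \<noteq> row_proj s"
      then show ?thesis using r False by simp
    next
      assume "col_proj t \<noteq> col_proj s"
      then have "s * col_proj t = 0" using c by simp
      then show ?thesis using False by (simp add: mult.assoc)
    qed
  qed
qed

lemma compress_sum_units:
  assumes "t \<in> U n" "S \<subseteq> U n"
  shows "row_proj t * \<Sum>S * col_proj t = (if t \<in> S then t else 0)"
proof -
  have "row_proj t * \<Sum>S * col_proj t = (\<Sum>s\<in>S. row_proj t * s * col_proj t)"
    by (simp add: sum_distrib_left sum_distrib_right)
  also have "\<dots> = (\<Sum>s\<in>S. if s = t then t else 0)"
    by (intro sum.cong refl compress_unit[of _ n]) (use assms in blast)+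
  finally show ?thesis using finite_subset[OF assms(2)] by (simp add: sum.delta)
qed

lemma diag_mult_sum_units:
  assumes "r \<in> diag n" "S \<subseteq> U n"
  shows "r * \<Sum>S = \<Sum>{s\<in>S. row_proj s = r}"
proof -
  have fS: "finite S" by (rule finite_subset[OF assms(2)]) simp
  have "r * \<Sum>S = (\<Sum>s\<in>S. if row_proj s = r then s else 0)"
    unfolding sum_distrib_left
    by (intro sum.cong refl) (use assms in \<open>auto simp: diag_mult_unit\<close>)
  then show ?thesis using sum.inter_filter[OF fS, of "\<lambda>s. s"] by simp
qed

lemma sum_row_mult_star:
  assumes S: "S \<subseteq> U n" and row: "\<And>s. s \<in> S \<Longrightarrow> row_proj s = r"
  shows "\<Sum>S * star (\<Sum>S) = real (card S) *\<^sub>R r"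
proof -
  have fS: "finite S" by (rule finite_subset[OF S]) simp
  have "s * star t = 0" if "s \<in> S" "t \<in> S" "s \<noteq> t" for s t
  proof (rule unit_mult_zero)
    show "col_proj s \<noteq> row_proj (star t)"
      using unit_eqI[of s n t] that S row by (auto simp: star_proj)
  qed (use that S in \<open>auto intro: star_units\<close>)
  then have "\<Sum>S * star (\<Sum>S) = (\<Sum>s\<in>S. s * star s)"
    unfolding star_sum by (intro sum_mult_sum_orthogonal fS)
  also have "\<dots> = (\<Sum>s\<in>S. r)"
    using row by (intro sum.cong refl) (simp only: row_proj_def)
  finally show ?thesis by (simp add: sum_constant_scaleR)
qed

definition refines where
  "refines n N \<longleftrightarrow> (\<forall>v\<in>U n. \<exists>S\<subseteq>U N. v = \<Sum>S)"

text \<open>Let \<open>r = row_proj t\<close>. In \<open>(r * v) * star (r * v) = r * row_proj v * r\<close> the left-hand side is \<open>r\<close>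
  times the number of summands of \<open>v\<close> in the row of \<open>t\<close>, and the right-hand side is \<open>0\<close> or \<open>r\<close> because
  \<open>row_proj v\<close> is itself a sum of distinct units. So \<open>t\<close> is alone in its row: the summands of \<open>v\<close>
  behave like the entries of a partial permutation matrix.\<close>
lemma refines_row_mult:
  assumes ref: "refines n N" and v: "v \<in> U n" and S: "S \<subseteq> U N" "v = \<Sum>S" and t: "t \<in> S"
  shows "row_proj t * v = t"
proof -
  have tU: "t \<in> U N" using S t by auto
  define r where "r = row_proj t"
  define Sr where "Sr = {s \<in> S. row_proj s = r}"
  have r: "r \<in> diag N" using tU row_diag r_def by auto
  have fin: "finite Sr" using finite_subset[OF S(1)] Sr_def by simp
  have rv: "r * v = \<Sum>Sr" using diag_mult_sum_units[OF r S(1)] S(2) Sr_def by simp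
  obtain S' where S': "S' \<subseteq> U N" "row_proj v = \<Sum>S'"
    using ref row_diag[OF v] diag_units unfolding refines_def by blast
  have "real (card Sr) *\<^sub>R r = r * v * star (r * v)"
    unfolding rv by (rule sum_row_mult_star[symmetric, of _ N]) (use S Sr_def in auto)
  also have "\<dots> = row_proj r * \<Sum>S' * col_proj r"
    unfolding S'(2)[symmetric] diag_row[OF r] diag_col[OF r]
    by (simp add: star_mult diag_star[OF r] row_proj_def mult.assoc)
  also have "\<dots> = (if r \<in> S' then r else 0)"
    by (rule compress_sum_units) (use r S' diag_units in auto)
  finally have eq: "real (card Sr) *\<^sub>R r = (if r \<in> S' then r else 0)" .
  have r0: "r \<noteq> 0" using r diag_units zero_notin_units by blast
  have tSr: "t \<in> Sr" using t r_def Sr_def by simp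
  then have "card Sr \<noteq> 0" using fin by auto
  then have "real (card Sr) *\<^sub>R r = 1 *\<^sub>R r" using eq r0 by (auto split: if_splits)
  then have "card Sr = 1" using r0 by (simp only: scaleR_cancel_right) simp
  then have "Sr = {t}" using tSr by (auto simp: card_1_singleton_iff)
  then show ?thesis using rv r_def by simp
qed

lemma refines_mult_col:
  assumes ref: "refines n N" and v: "v \<in> U n" and S: "S \<subseteq> U N" "v = \<Sum>S" and t: "t \<in> S"
  shows "v * col_proj t = t"
proof -
  have inj: "inj_on star S" by (rule inj_onI) (metis star_star)
  have "row_proj (star t) * star v = star t"
  proof (rule refines_row_mult[OF ref star_units[OF v]])
    show "star ` S \<subseteq> U N" using S star_units by auto
    show "star v = \<Sum>(star ` S)" using S inj by (simp add: star_sum sum.reindex)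
  qed (use t in auto)
  then have "star (row_proj (star t) * star v) = t" by (simp add: star_star)
  then show ?thesis by (simp add: star_mult star_star row_proj_def col_proj_def)
qed

lemma subunit_iff:
  assumes "t \<in> U N" "S \<subseteq> U N" "v = \<Sum>S"
  shows "subunit t v \<longleftrightarrow> t \<in> S"
  using compress_sum_units[OF assms(1,2)] assms zero_notin_units
  unfolding subunit_def by auto

lemma refines_subunit:
  assumes ref: "refines n N" and v: "v \<in> U n"
  shows "v = \<Sum>{t \<in> U N. subunit t v}"
    and "t \<in> U N \<Longrightarrow> row_proj t * v * col_proj t = (if subunit t v then t else 0)"
    and "t \<in> U N \<Longrightarrow> subunit t v \<Longrightarrow> row_proj t * v = t"
    and "t \<in> U N \<Longrightarrow> subunit t v \<Longrightarrow> v * col_proj t = t"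
proof -
  obtain S where S: "S \<subseteq> U N" "v = \<Sum>S" using ref v unfolding refines_def by blast
  have eq: "{t \<in> U N. subunit t v} = S" using subunit_iff[OF _ S] S by auto
  show "v = \<Sum>{t \<in> U N. subunit t v}" unfolding eq by (rule S(2))
  assume t: "t \<in> U N"
  show "row_proj t * v * col_proj t = (if subunit t v then t else 0)"
    using compress_sum_units[OF t S(1)] subunit_iff[OF t S] S(2) by simp
  assume "subunit t v"
  then have "t \<in> S" using subunit_iff[OF t S] by simp
  then show "row_proj t * v = t" "v * col_proj t = t"
    using refines_row_mult[OF ref v S] refines_mult_col[OF ref v S] by auto
qed

lemma subunit_row_col:
  assumes ref: "refines n N" and v: "v \<in> U n" and t: "t \<in> U N" "subunit t v"
  shows "row_proj t * row_proj v = row_proj t" "col_proj v * col_proj t = col_proj t"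
proof -
  note p = refines_subunit(3,4)[OF ref v t]
  have "star v * row_proj t = star t"
    using arg_cong[OF p(1), of star] by (simp add: star_mult row_proj_def star_star)
  then have "star v * (row_proj t * t) = star t * t" by (simp add: mult.assoc[symmetric])
  then have "star v * t = col_proj t" by (simp add: row_proj_mult[OF t(1)] col_proj_def)
  then show "col_proj v * col_proj t = col_proj t"
    using p(2) by (simp add: col_proj_def[of v] mult.assoc)
  have "col_proj t * star v = star t"
    using arg_cong[OF p(2), of star] by (simp add: star_mult col_proj_def star_star)
  then have "t * col_proj t * star v = t * star t" by (simp add: mult.assoc)
  then have "t * star v = row_proj t" by (simp add: mult_col_proj[OF t(1)] row_proj_def)
  then show "row_proj t * row_proj v = row_proj t"
    using p(1) by (simp add: row_proj_def[of v] mult.assoc[symmetric])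
qed

lemma subunit_unique:
  assumes ref: "refines n N" and v: "v \<in> U n" and w: "w \<in> U n" and t: "t \<in> U N"
    and tv: "subunit t v" and tw: "subunit t w"
  shows "v = w"
proof (rule unit_eqI[OF v w])
  have t0: "t \<noteq> 0" using t zero_notin_units by blast
  note p = subunit_row_col[OF ref v t tv] and q = refines_subunit(3,4)[OF ref w t tw]
  show "row_proj v = row_proj w"
  proof (rule ccontr)
    assume neq: "row_proj v \<noteq> row_proj w"
    have "t = row_proj t * (row_proj v * w)" using p(1) q(1) by (simp add: mult.assoc[symmetric])
    also have "\<dots> = 0" using neq diag_mult_unit[OF row_diag[OF v] w] by simp
    finally show False using t0 by simp
  qed
  show "col_proj v = col_proj w"
  proof (rule ccontr)
    assume neq: "col_proj v \<noteq> col_proj w"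
    have "t = (w * col_proj v) * col_proj t" using p(2) q(2) by (simp add: mult.assoc)
    also have "\<dots> = 0" using neq unit_mult_diag[OF col_diag[OF v] w] by simp
    finally show False using t0 by simp
  qed
qed

lemma refines_trans:
  assumes nM: "refines n M" and MN: "refines M N"
  shows "refines n N"
  unfolding refines_def
proof
  fix v assume "v \<in> U n"
  then obtain S where S: "S \<subseteq> U M" "v = \<Sum>S" using nM unfolding refines_def by blast
  define T where "T s = {t \<in> U N. subunit t s}" for s
  have fS: "finite S" by (rule finite_subset[OF S(1)]) simp
  have dis: "T s \<inter> T s' = {}" if "s \<in> S" "s' \<in> S" "s \<noteq> s'" for s s'
    using subunit_unique[OF MN, of s s'] that S(1) unfolding T_def by blast
  have "v = (\<Sum>s\<in>S. \<Sum>(T s))"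
    using S refines_subunit(1)[OF MN] by (auto simp: T_def intro!: sum.cong)
  also have "\<dots> = \<Sum>(\<Union>s\<in>S. T s)"
    by (rule sum.UNION_disjoint[symmetric]) (use fS dis in \<open>auto simp: T_def\<close>)
  finally show "\<exists>S\<subseteq>U N. v = \<Sum>S" by (intro exI[of _ "\<Union>s\<in>S. T s"]) (auto simp: T_def)
qed

lemma refines_le: "n \<le> N \<Longrightarrow> refines n N"
proof (induction rule: dec_induct)
  case base
  show ?case unfolding refines_def
  proof
    fix v assume "v \<in> U n"
    then show "\<exists>S\<subseteq>U n. v = \<Sum>S" by (intro exI[of _ "{v}"]) simp
  qed
next
  case (step N)
  have "refines N (Suc N)" using units_refine_Suc unfolding refines_def by blast
  with step.IH show ?case by (rule refines_trans)
qed

text \<open>Expand \<open>v\<close> at the level of \<open>f\<close>. Some summand has \<open>t\<close> as a subunit, and by uniqueness this summand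
  is \<open>f\<close>.\<close>
lemma subunit_laminar:
  assumes nm: "n \<le> m" and mN: "m \<le> N" and v: "v \<in> U n" and f: "f \<in> U m" and t: "t \<in> U N"
    and tv: "subunit t v" and tf: "subunit t f"
  shows "subunit f v"
proof -
  note rm = refines_le[OF mN]
  define S where "S = {s \<in> U m. subunit s v}"
  have vS: "v = \<Sum>S" unfolding S_def by (rule refines_subunit(1)[OF refines_le[OF nm] v])
  have "t = (\<Sum>s\<in>S. row_proj t * s * col_proj t)"
    using tv unfolding subunit_def by (subst (asm) vS) (simp add: sum_distrib_left sum_distrib_right)
  moreover have "t \<noteq> 0" using t zero_notin_units by blast
  ultimately obtain s where s: "s \<in> S" "row_proj t * s * col_proj t \<noteq> 0"
    by (metis (no_types, lifting) sum.neutral)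
  then have "subunit t s" using refines_subunit(2)[OF rm _ t, of s] S_def by (auto split: if_splits)
  then have "s = f" using subunit_unique[OF rm _ f t _ tf, of s] s S_def by auto
  then show ?thesis using s S_def by simp
qed

definition subunits where "subunits N v = {t \<in> U N. subunit t v}"

lemma finite_subunits [simp]: "finite (subunits N v)"
  by (simp add: subunits_def)

section \<open>Compressions and pinchings\<close>

text \<open>The part of \<open>x\<close> supported on \<open>v\<close>, seen from level \<open>N\<close>: in the groupoid picture, where a unit is a
  compact open set, this restricts \<open>x\<close> to a neighbourhood of \<open>v\<close> that shrinks to \<open>v\<close> as \<open>N\<close> grows.\<close>
definition compress where "compress N v x = (\<Sum>t\<in>subunits N v. row_proj t * x * col_proj t)"

lemma subunits_orthogonal:
  assumes "n \<le> N" "v \<in> U n" "s \<in> subunits N v" "t \<in> subunits N v" "s \<noteq> t"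
  shows "row_proj s * row_proj t = 0" "col_proj s * col_proj t = 0"
proof -
  note p = refines_subunit(3,4)[OF refines_le[OF assms(1)] assms(2)]
  have st: "s \<in> U N" "t \<in> U N" "subunit s v" "subunit t v" using assms by (auto simp: subunits_def)
  have "row_proj s \<noteq> row_proj t" using p(1)[of s] p(1)[of t] st assms(5) by metis
  then show "row_proj s * row_proj t = 0" using st by (simp add: diag_mult[OF row_diag row_diag])
  have "col_proj s \<noteq> col_proj t" using p(2)[of s] p(2)[of t] st assms(5) by metis
  then show "col_proj s * col_proj t = 0" using st by (simp add: diag_mult[OF col_diag col_diag])
qed

lemma norm_sum_subunit_corners:
  assumes nN: "n \<le> N" and v: "v \<in> U n" and S: "S \<subseteq> subunits N v"
    and M: "0 \<le> M" "\<And>t. t \<in> S \<Longrightarrow> norm (x t) \<le> M"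
  shows "norm (\<Sum>t\<in>S. row_proj t * x t * col_proj t) \<le> M"
proof (rule norm_sum_compressions)
  show "finite S" using finite_subset[OF S] by (simp add: subunits_def)
  fix s assume s: "s \<in> S"
  then have sU: "s \<in> U N" using S by (auto simp: subunits_def)
  show "projection (row_proj s)" "projection (col_proj s)"
    by (rule diag_projection[OF row_diag[OF sU]], rule diag_projection[OF col_diag[OF sU]])
  fix t assume t: "t \<in> S" "s \<noteq> t"
  have "s \<in> subunits N v" "t \<in> subunits N v" using S s t by auto
  note subunits_orthogonal[OF nN v this t(2)]
  then show "row_proj s * row_proj t = 0" "col_proj s * col_proj t = 0" .
qed (use M in auto)

lemma norm_corner_le:
  assumes "t \<in> U n"
  shows "norm (row_proj t * x * col_proj t) \<le> norm x"
  using assms by (intro norm_compress_le diag_projection[of _ n] row_diag col_diag)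

lemma norm_unit:
  assumes "t \<in> U n" shows "norm t = 1"
proof -
  have "norm (col_proj t) * norm (col_proj t) = norm (col_proj t)"
    using diag_projection[OF col_diag[OF assms]] cstar_identity[of "col_proj t"]
    by (simp add: projection_def power2_eq_square)
  moreover have "col_proj t \<noteq> 0"
    using diag_units[OF col_diag[OF assms]] zero_notin_units by metis
  ultimately have "(norm t)\<^sup>2 = 1" by (simp add: cstar_identity[symmetric] col_proj_def)
  then show ?thesis using power2_eq_1_iff[of "norm t"] norm_ge_zero[of t] by linarith
qed

lemma Bs_mono: "n \<le> N \<Longrightarrow> Bs n \<subseteq> Bs N"
proof -
  assume "n \<le> N"
  then have "refines n N" by (rule refines_le)
  have "U n \<subseteq> cspan (U N)"
  proof
    fix v assume "v \<in> U n"
    then obtain S where "S \<subseteq> U N" "v = \<Sum>S"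
      using \<open>refines n N\<close> unfolding refines_def by blast
    then show "v \<in> cspan (U N)"
      by (simp only:) (rule complex_vector.span_sum, rule complex_vector.span_base, blast)
  qed
  then show ?thesis
    unfolding span_units[symmetric]
    by (rule complex_vector.span_minimal) (rule complex_vector.subspace_span)
qed

lemma exists_close_element:
  assumes "x \<in> closure (\<Union>n. Bs n)" "0 < \<epsilon>"
  obtains N b where "n \<le> N" "b \<in> Bs N" "norm (x - b) < \<epsilon>"
proof -
  obtain b N where "b \<in> Bs N" "dist b x < \<epsilon>"
    using assms unfolding closure_approachable by blast
  then have "b \<in> Bs (max n N)" "norm (x - b) < \<epsilon>"
    using Bs_mono[of N "max n N"] by (auto simp: dist_norm norm_minus_commute)
  then show ?thesis using that[of "max n N" b] by simp
qed

lemma coefficients: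
  assumes "b \<in> Bs N"
  obtains \<beta> where "b = (\<Sum>t\<in>U N. \<beta> t *\<^sub>C t)"
    "\<And>t. t \<in> U N \<Longrightarrow> row_proj t * b * col_proj t = \<beta> t *\<^sub>C t"
proof -
  obtain \<beta> where b: "b = (\<Sum>t\<in>U N. \<beta> t *\<^sub>C t)"
    using assms unfolding span_units[symmetric] complex_vector.span_finite[OF finite_units] by auto
  have "row_proj t * b * col_proj t = \<beta> t *\<^sub>C t" if t: "t \<in> U N" for t
  proof -
    have "row_proj t * b * col_proj t = (\<Sum>s\<in>U N. \<beta> s *\<^sub>C (row_proj t * s * col_proj t))"
      unfolding b
      by (simp add: sum_distrib_left sum_distrib_right mult_scaleC_left mult_scaleC_right)
    also have "\<dots> = (\<Sum>s\<in>U N. if s = t then \<beta> t *\<^sub>C t else 0)"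
      by (intro sum.cong refl) (use t in \<open>auto simp: compress_unit\<close>)
    finally show ?thesis using t by (simp add: sum.delta)
  qed
  with b that show ?thesis by blast
qed

lemma compress_diff: "compress N v (x - y) = compress N v x - compress N v y"
  unfolding compress_def by (simp add: algebra_simps sum_subtractf)

lemma compress_sum: "compress N v (sum f S) = (\<Sum>s\<in>S. compress N v (f s))"
  unfolding compress_def sum_distrib_left sum_distrib_right by (rule sum.swap)

lemma compress_scaleR: "compress N v (a *\<^sub>R x) = a *\<^sub>R compress N v x"
  unfolding compress_def by (simp add: scaleR_sum_right)

lemma norm_compress:
  assumes "n \<le> N" "v \<in> U n"
  shows "norm (compress N v x) \<le> norm x"
  unfolding compress_def by (rule norm_sum_subunit_corners[OF assms]) auto

text \<open>The row and column projections of these units form an equivalence relation on minimal projections of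
  \<open>D\<^sub>N\<close>: two are related if a subunit of a unit of level \<open>n\<close> links them.\<close>
definition groupoid where "groupoid n N = {t \<in> U N. \<exists>f\<in>U n. subunit t f}"

definition pinch where "pinch n N x = (\<Sum>t\<in>groupoid n N. row_proj t * x * col_proj t)"

lemma pinch_diff: "pinch n N (x - y) = pinch n N x - pinch n N y"
  unfolding pinch_def by (simp add: algebra_simps sum_subtractf)

lemma groupoid_star:
  assumes "t \<in> groupoid n N"
  shows "star t \<in> groupoid n N"
proof -
  obtain f where f: "f \<in> U n" "subunit t f" and t: "t \<in> U N" using assms groupoid_def by auto
  have sa: "star (row_proj s) = row_proj s" "star (col_proj s) = col_proj s" for s :: 'a
    by (simp_all add: row_proj_def col_proj_def star_mult star_star)
  have "subunit (star t) (star f)"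
    using arg_cong[OF f(2)[unfolded subunit_def], of star]
    by (simp add: subunit_def star_proj star_mult sa mult.assoc)
  then show ?thesis using star_units f t groupoid_def by auto
qed

lemma groupoid_mult:
  assumes nN: "n \<le> N" and s: "s \<in> groupoid n N" and t: "t \<in> groupoid n N"
    and eq: "col_proj s = row_proj t"
  shows "s * t \<in> groupoid n N"
proof -
  obtain f where f: "f \<in> U n" "subunit s f" and sU: "s \<in> U N" using s groupoid_def by auto
  obtain g where g: "g \<in> U n" "subunit t g" and tU: "t \<in> U N" using t groupoid_def by auto
  note um = unit_mult[OF sU tU eq]
  have fg: "row_proj s * (f * g) * col_proj t = s * t"
  proof -
    have "row_proj s * f = s" "g * col_proj t = t"
      using refines_subunit(3,4)[OF refines_le[OF nN]] f g sU tU by auto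
    then show ?thesis by (metis mult.assoc)
  qed
  have "s * t \<noteq> 0" using um(1) zero_notin_units by metis
  then have "f * g \<noteq> 0" using fg by auto
  then have "col_proj f = row_proj g" using unit_mult_zero f g by blast
  then have "f * g \<in> U n" using unit_mult f g by blast
  moreover have "subunit (s * t) (f * g)" unfolding subunit_def um(2,3) by (rule fg)
  ultimately show ?thesis using um(1) groupoid_def by auto
qed

lemma projection_sum_diag:
  assumes "C \<subseteq> diag N" shows "projection (\<Sum>C)"
proof -
  have fC: "finite C" using finite_subset[OF _ finite_units[of N]] assms diag_units by blast
  have "\<Sum>C * \<Sum>C = (\<Sum>r\<in>C. r * r)"
    by (rule sum_mult_sum_orthogonal[OF fC]) (use assms diag_mult[of _ N] in fastforce)
  also have "\<dots> = \<Sum>C" by (intro sum.cong refl) (use assms diag_mult in auto)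
  finally show ?thesis
    unfolding projection_def star_sum using assms diag_star by (auto intro!: sum.cong)
qed

text \<open>The sums of the equivalence classes are orthogonal projections \<open>z\<close> (minimal among those of \<open>D\<^sub>N\<close> that
  commute with \<open>B\<^sub>n\<close> and lie below its unit), and the pinching is the sum of the \<open>z * x * z\<close>. The bound has no
  factor depending on \<open>n\<close>, which is essential: the distance from a given element to \<open>B\<^sub>n\<close> may tend to
  \<open>0\<close> arbitrarily slowly.\<close>
lemma norm_pinch:
  assumes nN: "n \<le> N"
  shows "norm (pinch n N x) \<le> norm x"
proof -
  define Z where "Z = groupoid n N"
  define E where "E = (\<lambda>t. (row_proj t, col_proj t)) ` Z"
  define P where "P = row_proj ` Z"
  have ZU: "Z \<subseteq> U N" by (auto simp: Z_def groupoid_def)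
  have Zstar: "star t \<in> Z" if "t \<in> Z" for t using that groupoid_star Z_def by auto
  have Zmult: "s * t \<in> Z" if "s \<in> Z" "t \<in> Z" "col_proj s = row_proj t" for s t
    using that groupoid_mult[OF nN] Z_def by auto
  have Zrow: "row_proj t \<in> Z" if "t \<in> Z" for t
    unfolding row_proj_def using Zmult[OF that Zstar[OF that]] by (simp only: star_proj)
  have PD: "P \<subseteq> diag N" using ZU row_diag P_def by auto
  have "finite Z" using finite_subset[OF ZU] by simp
  then have fP: "finite P" by (simp add: P_def)
  have "equiv P E"
  proof (rule equivI)
    have colP: "col_proj t \<in> P" if "t \<in> Z" for t
      unfolding P_def star_proj(1)[of t, symmetric] by (intro imageI Zstar that)
    then show "E \<subseteq> P \<times> P" by (auto simp: E_def P_def)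
    show "refl_on P E"
    proof (rule refl_onI)
      fix r assume "r \<in> P"
      then have "r \<in> Z" "r \<in> diag N" using Zrow PD P_def by auto
      then have "(row_proj r, col_proj r) \<in> E" by (simp add: E_def)
      then show "(r, r) \<in> E" using \<open>r \<in> diag N\<close> by (simp add: diag_row diag_col)
    qed
    show "sym E"
    proof (rule symI)
      fix a b assume "(a, b) \<in> E"
      then obtain t where "t \<in> Z" "a = row_proj t" "b = col_proj t" by (auto simp: E_def)
      then show "(b, a) \<in> E"
        unfolding E_def by (intro image_eqI[of _ _ "star t"] Zstar) (simp_all add: star_proj)
    qed
    show "trans E"
    proof (rule transI)
      fix a b c assume "(a, b) \<in> E" "(b, c) \<in> E"
      then obtain s t where st: "s \<in> Z" "a = row_proj s" "b = col_proj s"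
        "t \<in> Z" "b = row_proj t" "c = col_proj t" by (auto simp: E_def)
      then have "s * t \<in> Z" "row_proj (s * t) = a" "col_proj (s * t) = c"
        using Zmult unit_mult[of s N t] ZU by auto
      then show "(a, c) \<in> E" unfolding E_def by (intro image_eqI[of _ _ "s * t"]) simp_all
    qed
  qed
  note eqv = this
  define K where "K = P // E"
  have KP: "C \<subseteq> P" if "C \<in> K" for C
    using that Union_quotient[OF eqv] K_def by auto
  have fK: "finite K"
    by (rule finite_subset[of _ "Pow P"]) (use KP fP in auto)
  have disj: "C \<inter> C' = {}" if "C \<in> K" "C' \<in> K" "C \<noteq> C'" for C C'
    using quotient_disj[OF eqv] that K_def by auto
  have fC: "finite C" if "C \<in> K" for C using KP[OF that] fP finite_subset by auto
  have EK: "E = (\<Union>C\<in>K. C \<times> C)"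
  proof
    show "E \<subseteq> (\<Union>C\<in>K. C \<times> C)"
    proof
      fix q assume "q \<in> E"
      then obtain a b where q: "q = (a, b)" "(a, b) \<in> E" by (cases q) auto
      then have "a \<in> P" by (auto simp: E_def P_def)
      then have "E `` {a} \<in> K" "a \<in> E `` {a}"
        unfolding K_def by (rule quotientI, rule equiv_class_self[OF eqv])
      then show "q \<in> (\<Union>C\<in>K. C \<times> C)" using q by blast
    qed
    show "(\<Union>C\<in>K. C \<times> C) \<subseteq> E"
    proof clarify
      fix C a b assume "C \<in> K" "a \<in> C" "b \<in> C"
      then show "(a, b) \<in> E"
        unfolding K_def by (intro in_quotient_imp_in_rel[OF eqv, of C]) auto
    qed
  qed
  have inj: "inj_on (\<lambda>t. (row_proj t, col_proj t)) Z"
    by (rule inj_onI) (use unit_eqI ZU in blast)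
  have "pinch n N x = (\<Sum>(a, b)\<in>E. a * x * b)"
    unfolding pinch_def E_def Z_def[symmetric] by (simp add: sum.reindex[OF inj])
  also have "\<dots> = (\<Sum>C\<in>K. \<Sum>(a, b)\<in>C \<times> C. a * x * b)"
    unfolding EK by (rule sum.UNION_disjoint[OF fK]) (use fC disj in blast)+
  also have "\<dots> = (\<Sum>C\<in>K. \<Sum>C * x * \<Sum>C)"
    by (intro sum.cong refl)
       (simp add: sum_distrib_left sum_distrib_right sum.cartesian_product[symmetric],
        rule sum.swap)
  also have "norm \<dots> \<le> norm x"
  proof (rule norm_sum_compressions[OF fK])
    show pr: "projection (\<Sum>C)" if "C \<in> K" for C
      using projection_sum_diag[of C N] KP[OF that] PD by auto
    then show "projection (\<Sum>C)" if "C \<in> K" for C using that .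
    show orth: "\<Sum>C * \<Sum>C' = 0" if "C \<in> K" "C' \<in> K" "C \<noteq> C'" for C C'
      unfolding sum_product
    proof (intro sum.neutral ballI)
      fix r r' assume rr: "r \<in> C" "r' \<in> C'"
      then have "r \<noteq> r'" using disj that by blast
      moreover have "r \<in> diag N" "r' \<in> diag N" using rr KP that PD by auto
      ultimately show "r * r' = 0" by (simp add: diag_mult)
    qed
    then show "\<Sum>C * \<Sum>C' = 0" if "C \<in> K" "C' \<in> K" "C \<noteq> C'" for C C' using that .
  qed auto
  finally show ?thesis .
qed

lemma groupoid_UN: "groupoid n N = (\<Union>f\<in>U n. subunits N f)"
  by (auto simp: groupoid_def subunits_def)

lemma sum_subunits: "n \<le> N \<Longrightarrow> v \<in> U n \<Longrightarrow> \<Sum>(subunits N v) = v"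
  unfolding subunits_def using refines_subunit(1)[OF refines_le] by metis

lemma sum_groupoid:
  assumes nN: "n \<le> N"
  shows "(\<Sum>t\<in>groupoid n N. h t) = (\<Sum>f\<in>U n. \<Sum>t\<in>subunits N f. h t)"
  unfolding groupoid_UN
proof (rule sum.UNION_disjoint)
  show "\<forall>f\<in>U n. finite (subunits N f)" by (simp add: subunits_def)
  show "\<forall>f\<in>U n. \<forall>g\<in>U n. f \<noteq> g \<longrightarrow> subunits N f \<inter> subunits N g = {}"
    using subunit_unique[OF refines_le[OF nN]] by (auto simp: subunits_def)
qed simp

lemma pinch_unit:
  assumes nN: "n \<le> N" and f: "f \<in> U n"
  shows "pinch n N f = f"
proof -
  have "pinch n N f = (\<Sum>g\<in>U n. \<Sum>t\<in>subunits N g. row_proj t * f * col_proj t)"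
    unfolding pinch_def by (rule sum_groupoid[OF nN])
  also have "\<dots> = (\<Sum>g\<in>U n. if g = f then \<Sum>(subunits N f) else 0)"
  proof (rule sum.cong[OF refl])
    fix g assume g: "g \<in> U n"
    have "row_proj t * f * col_proj t = (if g = f then t else 0)" if "t \<in> subunits N g" for t
      using that refines_subunit(2)[OF refines_le[OF nN] f, of t]
        subunit_unique[OF refines_le[OF nN] f g, of t] by (auto simp: subunits_def)
    then show "(\<Sum>t\<in>subunits N g. row_proj t * f * col_proj t) = (if g = f then \<Sum>(subunits N f) else 0)"
      by simp
  qed
  also have "\<dots> = f" using f sum_subunits[OF nN f] by (simp add: sum.delta)
  finally show ?thesis .
qed

lemma pinch_fixes:
  assumes nN: "n \<le> N" and b: "b \<in> Bs n"
  shows "pinch n N b = b"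
proof -
  obtain \<beta> where \<beta>: "b = (\<Sum>t\<in>U n. \<beta> t *\<^sub>C t)" using coefficients[OF b] by blast
  have "pinch n N b = (\<Sum>f\<in>U n. \<beta> f *\<^sub>C pinch n N f)"
    unfolding \<beta> pinch_def complex_vector.scale_sum_right
    by (subst sum.swap)
       (simp add: sum_distrib_left sum_distrib_right mult_scaleC_left mult_scaleC_right)
  also have "\<dots> = b" unfolding \<beta> by (intro sum.cong refl) (simp add: pinch_unit[OF nN])
  finally show ?thesis .
qed

end

section \<open>Closed bimodules over the diagonal\<close>

locale diagonal_bimodule = nested_matrix_units +
  fixes I
  assumes closed: "closed I" and subspace: "csubspace I"
    and within: "I \<subseteq> closure (\<Union>n. Bs n)"
    and left: "r \<in> diag n \<Longrightarrow> x \<in> I \<Longrightarrow> r * x \<in> I"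
    and right: "r \<in> diag n \<Longrightarrow> x \<in> I \<Longrightarrow> x * r \<in> I"
begin

lemmas sum_mem = complex_vector.subspace_sum[OF subspace]
  and scale_mem = complex_vector.subspace_scale[OF subspace]

lemma corner_mem: "t \<in> U n \<Longrightarrow> x \<in> I \<Longrightarrow> row_proj t * x * col_proj t \<in> I"
  by (intro right[OF col_diag] left[OF row_diag])

lemma compress_mem: "x \<in> I \<Longrightarrow> compress N v x \<in> I"
  unfolding compress_def by (intro sum_mem corner_mem) (auto simp: subunits_def)

text \<open>The compression of \<open>y\<close> to \<open>v\<close> at a high level \<open>N\<close> is almost a diagonal element times \<open>v\<close>, say with
  coefficients \<open>\<beta> t\<close> on the subunits \<open>t\<close> of \<open>v\<close>. Since \<open>y\<close> is within \<open>\<eta> < 1\<close> of \<open>v\<close>, these coefficients are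
  bounded away from \<open>0\<close> uniformly in \<open>N\<close>, so dividing by them keeps the result in \<open>I\<close> and brings it
  close to \<open>v\<close>.\<close>
lemma near_unit_mem:
  assumes v: "v \<in> U n" and y: "y \<in> I" and near: "norm (v - y) < 1"
  shows "v \<in> I"
proof -
  define \<eta> where "\<eta> = norm (v - y)"
  have "\<exists>z\<in>I. dist z v < \<epsilon>" if \<epsilon>: "0 < \<epsilon>" for \<epsilon>
  proof -
    \<comment> \<open>The first bound keeps the coefficients at least \<open>(1 - \<eta>) / 2\<close>; the second absorbs the factor
      \<open>2 / (1 - \<eta>)\<close> that the division then costs.\<close>
    define \<kappa> where "\<kappa> = min ((1 - \<eta>) / 2) (\<epsilon> * (1 - \<eta>) / 4)"
    have \<kappa>: "0 < \<kappa>" "\<kappa> \<le> (1 - \<eta>) / 2" "\<kappa> \<le> \<epsilon> * (1 - \<eta>) / 4"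
      unfolding \<kappa>_def using near[folded \<eta>_def] \<epsilon> by (simp_all only: min.cobounded1 min.cobounded2) simp
    obtain N b where N: "n \<le> N" and b: "b \<in> Bs N" "norm (y - b) < \<kappa>"
      using exists_close_element[of y \<kappa> n] within y \<kappa>(1) by blast
    obtain \<beta> where \<beta>: "\<And>t. t \<in> U N \<Longrightarrow> row_proj t * b * col_proj t = \<beta> t *\<^sub>C t"
      using coefficients[OF b(1)] by blast
    have big: "(1 - \<eta>) / 2 \<le> cmod (\<beta> t)" if t: "t \<in> subunits N v" for t
    proof -
      have tU: "t \<in> U N" "row_proj t * v * col_proj t = t"
        using t by (auto simp: subunits_def subunit_def)
      have "row_proj t * (b - v) * col_proj t = \<beta> t *\<^sub>C t - 1 *\<^sub>C t"
        using \<beta>[OF tU(1)] tU(2) by (simp add: algebra_simps)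
      also have "\<dots> = (\<beta> t - 1) *\<^sub>C t"
        by (simp only: complex_vector.scale_left_diff_distrib)
      finally have "cmod (\<beta> t - 1) = norm (row_proj t * (b - v) * col_proj t)"
        by (simp add: norm_scaleC norm_unit[OF tU(1)])
      also have "\<dots> \<le> norm (b - v)" by (rule norm_corner_le[OF tU(1)])
      also have "\<dots> \<le> norm (v - y) + norm (y - b)"
        using norm_triangle_ineq[of "v - y" "y - b"] by (simp add: norm_minus_commute)
      also have "\<dots> \<le> \<eta> + (1 - \<eta>) / 2" using b \<kappa> \<eta>_def by simp
      finally show ?thesis
        using norm_triangle_ineq2[of 1 "1 - \<beta> t"] by (simp add: norm_minus_commute field_simps)
    qed
    define z where "z = (\<Sum>t\<in>subunits N v. inverse (\<beta> t) *\<^sub>C (row_proj t * y * col_proj t))"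
    have "z \<in> I" unfolding z_def
      by (intro sum_mem scale_mem corner_mem[of _ N] y) (auto simp: subunits_def)
    have nz: "\<beta> t \<noteq> 0" if "t \<in> subunits N v" for t
      using big[OF that] near by (auto simp: \<eta>_def)
    have "v = (\<Sum>t\<in>subunits N v. inverse (\<beta> t) *\<^sub>C (row_proj t * b * col_proj t))"
    proof -
      have "(\<Sum>t\<in>subunits N v. inverse (\<beta> t) *\<^sub>C (row_proj t * b * col_proj t)) = \<Sum>(subunits N v)"
      proof (rule sum.cong[OF refl])
        fix t assume t: "t \<in> subunits N v"
        then have "row_proj t * b * col_proj t = \<beta> t *\<^sub>C t" using \<beta> by (simp add: subunits_def)
        then show "inverse (\<beta> t) *\<^sub>C (row_proj t * b * col_proj t) = t"
          using nz[OF t] by simp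
      qed
      then show ?thesis using sum_subunits[OF N v] by simp
    qed
    then have "v - z = (\<Sum>t\<in>subunits N v. inverse (\<beta> t) *\<^sub>C (row_proj t * b * col_proj t)
        - inverse (\<beta> t) *\<^sub>C (row_proj t * y * col_proj t))"
      unfolding z_def sum_subtractf by simp
    also have "\<dots> = (\<Sum>t\<in>subunits N v. row_proj t * (inverse (\<beta> t) *\<^sub>C (b - y)) * col_proj t)"
      by (intro sum.cong refl)
         (simp add: mult_scaleC_left mult_scaleC_right complex_vector.scale_right_diff_distrib
          right_diff_distrib left_diff_distrib)
    also have "norm \<dots> \<le> \<epsilon> / 2"
    proof (rule norm_sum_subunit_corners[OF N v order_refl])
      fix t assume t: "t \<in> subunits N v"
      have "norm (inverse (\<beta> t) *\<^sub>C (b - y)) = norm (b - y) / cmod (\<beta> t)"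
        by (simp only: norm_scaleC norm_inverse) (simp only: divide_inverse mult.commute)
      also have "\<dots> \<le> \<kappa> / ((1 - \<eta>) / 2)"
        using b big[OF t] near \<kappa> by (intro frac_le) (auto simp: norm_minus_commute \<eta>_def)
      also have "\<dots> \<le> \<epsilon> / 2" using \<kappa>(3) near by (simp add: \<eta>_def field_simps)
      finally show "norm (inverse (\<beta> t) *\<^sub>C (b - y)) \<le> \<epsilon> / 2" .
    qed (use \<epsilon> in simp)
    finally have "dist z v < \<epsilon>" using \<epsilon> by (simp add: dist_norm norm_minus_commute)
    with \<open>z \<in> I\<close> show ?thesis by blast
  qed
  then have "v \<in> closure I" unfolding closure_approachable by blast
  then show ?thesis using closed by simp
qed

text \<open>Rescale the corner of \<open>x\<close> at \<open>t\<close>: a larger coefficient would put an element of \<open>I\<close> at distance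
  less than \<open>1\<close> from \<open>t\<close>.\<close>
lemma small_coefficient:
  assumes t: "t \<in> U N" "t \<notin> I" and x: "x \<in> I"
    and c: "row_proj t * b * col_proj t = c *\<^sub>C t"
  shows "cmod c \<le> norm (x - b)"
proof (rule ccontr)
  assume large: "\<not> cmod c \<le> norm (x - b)"
  then have c0: "c \<noteq> 0" using norm_ge_zero[of "x - b"] by auto
  define y where "y = inverse c *\<^sub>C (row_proj t * x * col_proj t)"
  have y: "y \<in> I" unfolding y_def by (intro scale_mem corner_mem[of _ N] t x)
  have "t - y = inverse c *\<^sub>C (row_proj t * (b - x) * col_proj t)"
    using c c0
    by (simp add: y_def right_diff_distrib left_diff_distrib complex_vector.scale_right_diff_distrib)
  then have "norm (t - y) = norm (row_proj t * (b - x) * col_proj t) / cmod c"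
    by (simp only: norm_scaleC norm_inverse) (simp only: divide_inverse mult.commute)
  also have "\<dots> \<le> norm (b - x) / cmod c"
    by (intro divide_right_mono norm_corner_le[OF t(1)]) simp
  also have "\<dots> < 1" using large c0 by (simp add: norm_minus_commute)
  finally show False using near_unit_mem[OF t(1) y] t by simp
qed

theorem mem_closure_span_units:
  assumes x: "x \<in> I"
  shows "x \<in> closure (cspan (\<Union>n. U n \<inter> I))"
  unfolding closure_approachable
proof (intro allI impI)
  fix \<epsilon> :: real assume "0 < \<epsilon>"
  \<comment> \<open>The three errors are \<open>x - b0\<close>, the pinching of \<open>b0 - b\<close>, and the dropped units, of norm less
    than \<open>\<delta>\<close>, at most \<open>2 * \<delta>\<close> and at most \<open>\<delta>\<close> respectively.\<close>
  define \<delta> where "\<delta> = \<epsilon> / 4"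
  have \<delta>: "0 < \<delta>" using \<open>0 < \<epsilon>\<close> by (simp add: \<delta>_def)
  obtain n b0 where b0: "b0 \<in> Bs n" "norm (x - b0) < \<delta>"
    using exists_close_element[of x \<delta> 0] within x \<delta> by blast
  \<comment> \<open>The second approximation is chosen after \<open>n\<close>, so that its error can beat the number of units
    of level \<open>n\<close>.\<close>
  define \<gamma> where "\<gamma> = \<delta> / (real (card (U n)) + 1)"
  have \<gamma>: "0 < \<gamma>" "\<gamma> \<le> \<delta>" "real (card (U n)) * \<gamma> \<le> \<delta>"
    using \<delta> by (auto simp: \<gamma>_def field_simps)
  obtain N b where N: "n \<le> N" and b: "b \<in> Bs N" "norm (x - b) < \<gamma>"
    using exists_close_element[of x \<gamma> n] within x \<gamma> by blast
  obtain \<beta> where \<beta>: "\<And>t. t \<in> U N \<Longrightarrow> row_proj t * b * col_proj t = \<beta> t *\<^sub>C t"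
    using coefficients[OF b(1)] by blast
  define y where "y = (\<Sum>f\<in>U n. \<Sum>t\<in>subunits N f \<inter> I. \<beta> t *\<^sub>C t)"
  have "y \<in> cspan (\<Union>n. U n \<inter> I)" unfolding y_def
    by (intro complex_vector.span_sum complex_vector.span_scale complex_vector.span_base)
       (auto simp: subunits_def)
  moreover have "norm (pinch n N b - y) \<le> \<delta>"
  proof -
    have "pinch n N b = (\<Sum>f\<in>U n. \<Sum>t\<in>subunits N f. \<beta> t *\<^sub>C t)"
      unfolding pinch_def sum_groupoid[OF N]
      by (intro sum.cong refl) (auto simp: subunits_def \<beta>)
    then have diff: "pinch n N b - y = (\<Sum>f\<in>U n. \<Sum>t\<in>subunits N f - I. \<beta> t *\<^sub>C t)"
      unfolding y_def sum.Int_Diff[where B = I, OF finite_subunits] by (simp add: sum.distrib)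
    have "norm (pinch n N b - y) \<le> (\<Sum>f\<in>U n. norm (\<Sum>t\<in>subunits N f - I. \<beta> t *\<^sub>C t))"
      unfolding diff by (rule norm_sum)
    also have "\<dots> \<le> (\<Sum>f\<in>U n. \<gamma>)"
    proof (rule sum_mono)
      fix f assume f: "f \<in> U n"
      have eq: "(\<Sum>t\<in>subunits N f - I. \<beta> t *\<^sub>C t)
          = (\<Sum>t\<in>subunits N f - I. row_proj t * (\<beta> t *\<^sub>C t) * col_proj t)"
      proof (rule sum.cong[OF refl])
        fix t assume "t \<in> subunits N f - I"
        then have "t \<in> U N" by (simp add: subunits_def)
        then have "row_proj t * t * col_proj t = t" using compress_unit[of t N t] by simp
        then show "\<beta> t *\<^sub>C t = row_proj t * (\<beta> t *\<^sub>C t) * col_proj t"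
          by (simp only: mult_scaleC_left mult_scaleC_right)
      qed
      show "norm (\<Sum>t\<in>subunits N f - I. \<beta> t *\<^sub>C t) \<le> \<gamma>"
        unfolding eq
      proof (rule norm_sum_subunit_corners[OF N f])
        fix t assume "t \<in> subunits N f - I"
        then have t: "t \<in> U N" "t \<notin> I" by (auto simp: subunits_def)
        show "norm (\<beta> t *\<^sub>C t) \<le> \<gamma>"
          using small_coefficient[OF t x \<beta>[OF t(1)]] b by (simp add: norm_scaleC norm_unit[OF t(1)])
      qed (use \<gamma> in auto)
    qed
    also have "\<dots> \<le> \<delta>" using \<gamma> by simp
    finally show ?thesis .
  qed
  moreover have "norm (b0 - pinch n N b) \<le> 2 * \<delta>"
  proof -
    have "norm (b0 - pinch n N b) = norm (pinch n N (b0 - b))"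
      by (simp add: pinch_diff pinch_fixes[OF N b0(1)])
    also have "\<dots> \<le> norm (b0 - b)" by (rule norm_pinch[OF N])
    also have "\<dots> \<le> norm (x - b0) + norm (x - b)"
      using norm_triangle_ineq4[of "x - b" "x - b0"] by simp
    finally show ?thesis using b b0 \<gamma> by simp
  qed
  ultimately have "norm (x - y) < 4 * \<delta>"
    using norm_triangle_ineq[of "x - b0" "b0 - y"]
      norm_triangle_ineq[of "b0 - pinch n N b" "pinch n N b - y"] b0(2) \<delta> by simp
  then show "\<exists>y\<in>cspan (\<Union>n. U n \<inter> I). dist y x < \<epsilon>"
    using \<open>y \<in> _\<close> by (auto simp: dist_norm norm_minus_commute \<delta>_def)
qed

section \<open>A generator\<close>

text \<open>Units of different levels may be equal as elements. Such a repeated unit is a subunit of its earlier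
  occurrence, so only its first occurrence is listed here.\<close>
definition maximal_units where
  "maximal_units n = {v \<in> U n \<inter> I. \<forall>m<n. \<forall>f\<in>U m \<inter> I. \<not> subunit v f}"

text \<open>The factor \<open>(1 / 2) ^ m\<close> makes the series below converge absolutely; the other one compensates for
  the size of the finite sum it multiplies.\<close>
definition weight :: "nat \<Rightarrow> real" where
  "weight m = (1 / 2) ^ m / (1 + norm (\<Sum>(maximal_units m)))"

definition generator where "generator = (\<Sum>m. weight m *\<^sub>R \<Sum>(maximal_units m))"

lemma weight_pos: "0 < weight m"
  unfolding weight_def by (simp add: add_pos_nonneg)

lemma scaleR_mem: "x \<in> I \<Longrightarrow> a *\<^sub>R x \<in> I"
  unfolding scaleC_of_real[symmetric] by (rule scale_mem)

lemma generator_sums: "(\<lambda>m. weight m *\<^sub>R \<Sum>(maximal_units m)) sums generator"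
  unfolding generator_def
proof (rule summable_sums, rule summable_comparison_test)
  have "norm (weight m *\<^sub>R \<Sum>(maximal_units m)) \<le> (1 / 2) ^ m" for m
  proof -
    have "norm (weight m *\<^sub>R \<Sum>(maximal_units m))
        = (1 / 2) ^ m * (norm (\<Sum>(maximal_units m)) / (1 + norm (\<Sum>(maximal_units m))))"
      using weight_pos[of m] by (simp add: weight_def)
    also have "\<dots> \<le> (1 / 2) ^ m * 1"
      by (intro mult_left_mono) (auto simp: divide_le_eq add_pos_nonneg)
    finally show ?thesis by simp
  qed
  then show "\<exists>N. \<forall>m\<ge>N. norm (weight m *\<^sub>R \<Sum>(maximal_units m)) \<le> (1 / 2) ^ m" by blast
qed (rule summable_geometric, simp)

lemma generator_mem: "generator \<in> I"
proof (rule closed_sequentially[OF closed])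
  show "(\<Sum>m<n. weight m *\<^sub>R \<Sum>(maximal_units m)) \<in> I" for n
    by (intro sum_mem scaleR_mem) (auto simp: maximal_units_def)
  show "(\<lambda>n. \<Sum>m<n. weight m *\<^sub>R \<Sum>(maximal_units m)) \<longlonglongrightarrow> generator"
    using generator_sums by (simp add: sums_def)
qed

text \<open>A common subunit of \<open>w\<close> and another maximal unit would make one of the two a subunit of the other.\<close>
lemma compress_maximal_units:
  assumes w: "w \<in> maximal_units n" and nN: "n \<le> N" and mN: "m \<le> N"
  shows "compress N w (\<Sum>(maximal_units m)) = (if m = n then w else 0)"
proof -
  have wU: "w \<in> U n" "w \<in> I" using w by (auto simp: maximal_units_def)
  have *: "compress N w f = (if f = w \<and> m = n then w else 0)" if f: "f \<in> maximal_units m" for f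
  proof -
    have fU: "f \<in> U m" "f \<in> I" using f by (auto simp: maximal_units_def)
    have "row_proj t * f * col_proj t = (if f = w \<and> m = n then t else 0)" if t: "t \<in> subunits N w" for t
    proof -
      have tU: "t \<in> U N" "subunit t w" using t by (auto simp: subunits_def)
      have "f = w \<and> m = n" if tf: "subunit t f"
      proof (cases m n rule: linorder_cases)
        case less
        then have "subunit w f"
          using subunit_laminar[OF _ nN fU(1) wU(1) tU(1) tf tU(2)] by simp
        then show ?thesis using w less fU by (auto simp: maximal_units_def)
      next
        case equal
        then show ?thesis
          using subunit_unique[OF refines_le[OF nN] _ wU(1) tU(1) tf tU(2)] fU by simp
      next
        case greater
        then have "subunit f w"
          using subunit_laminar[OF _ mN wU(1) fU(1) tU(1) tU(2) tf] by simp
        then show ?thesis using f greater wU by (auto simp: maximal_units_def)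
      qed
      then have "subunit t f \<longleftrightarrow> f = w \<and> m = n" using tU(2) by blast
      then show ?thesis using refines_subunit(2)[OF refines_le[OF mN] fU(1) tU(1)] by simp
    qed
    then have "compress N w f = (\<Sum>t\<in>subunits N w. if f = w \<and> m = n then t else 0)"
      unfolding compress_def by (intro sum.cong refl)
    also have "\<dots> = (if f = w \<and> m = n then \<Sum>(subunits N w) else 0)"
      by (cases "f = w \<and> m = n") (simp_all only: if_True if_False sum.neutral_const simp_thms)
    finally show ?thesis unfolding sum_subunits[OF nN wU(1)] .
  qed
  have fin: "finite (maximal_units m)"
    by (rule finite_subset[OF _ finite_units[of m]]) (auto simp: maximal_units_def)
  have "compress N w (\<Sum>(maximal_units m))
      = (\<Sum>f\<in>maximal_units m. if f = w then if m = n then w else 0 else 0)"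
    unfolding compress_sum by (intro sum.cong refl) (simp add: *)
  also have "\<dots> = (if m = n then w else 0)"
    using w by (simp add: sum.delta[OF fin])
  finally show ?thesis .
qed

end

context nested_matrix_units
begin

text \<open>Compressing the generator to a maximal unit \<open>w\<close> at level \<open>N\<close> kills every term of level at most \<open>N\<close>
  except the one with \<open>w\<close> itself, and does not increase the norm of the tail. The other units of \<open>I\<close> are
  corners of units of \<open>I\<close> at earlier levels, so they follow by induction on the level.\<close>
lemma generator_generates:
  assumes I: "diagonal_bimodule Bs l k e I" and J: "diagonal_bimodule Bs l k e J"
    and gJ: "diagonal_bimodule.generator l k e I \<in> J"
  shows "I \<subseteq> J"
proof -
  interpret I: diagonal_bimodule Bs l k e I by (rule I)
  interpret J: diagonal_bimodule Bs l k e J by (rule J)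
  have maximal: "w \<in> J" if w: "w \<in> I.maximal_units n" for w n
  proof -
    have wU: "w \<in> U n" using w by (simp add: I.maximal_units_def)
    define s where "s N = (\<Sum>m<Suc N. I.weight m *\<^sub>R \<Sum>(I.maximal_units m))" for N
    have "(\<lambda>N. s N) \<longlonglongrightarrow> I.generator"
      using I.generator_sums unfolding s_def sums_def by (rule LIMSEQ_Suc)
    then have "(\<lambda>N. I.generator - s N) \<longlonglongrightarrow> I.generator - I.generator"
      by (intro tendsto_diff tendsto_const)
    then have lim: "(\<lambda>N. norm (I.generator - s N)) \<longlonglongrightarrow> 0"
      by (intro tendsto_norm_zero) simp
    have cs: "compress N w (s N) = I.weight n *\<^sub>R w" if N: "n \<le> N" for N
    proof -
      have "compress N w (s N) = (\<Sum>m<Suc N. if m = n then I.weight n *\<^sub>R w else 0)"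
        unfolding s_def compress_sum[of N w _ "{..<Suc N}"] compress_scaleR
        by (intro sum.cong refl) (simp add: I.compress_maximal_units[OF w N])
      then show ?thesis using N by (simp add: sum.delta)
    qed
    have "(\<lambda>N. compress N w I.generator) \<longlonglongrightarrow> I.weight n *\<^sub>R w"
    proof (rule LIM_zero_cancel, rule Lim_null_comparison[OF _ lim])
      show "\<forall>\<^sub>F N in sequentially.
          norm (compress N w I.generator - I.weight n *\<^sub>R w) \<le> norm (I.generator - s N)"
        using eventually_ge_at_top[of n]
      proof eventually_elim
        case (elim N)
        then show ?case
          using norm_compress[OF elim wU] by (simp add: cs[symmetric] compress_diff[symmetric])
      qed
    qed
    then have "I.weight n *\<^sub>R w \<in> J"
      by (rule closed_sequentially[OF J.closed J.compress_mem[OF gJ]])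
    then have "(1 / I.weight n) *\<^sub>R (I.weight n *\<^sub>R w) \<in> J" by (rule J.scaleR_mem)
    then show ?thesis using I.weight_pos[of n] by simp
  qed
  have units: "v \<in> J" if v: "v \<in> U n" "v \<in> I" for v n
    using v
  proof (induction n arbitrary: v rule: less_induct)
    case (less n)
    show ?case
    proof (cases "v \<in> I.maximal_units n")
      case False
      then obtain m f where m: "m < n" and f: "f \<in> U m" "f \<in> I" "subunit v f"
        using less.prems by (auto simp: I.maximal_units_def)
      have "row_proj v * f * col_proj v \<in> J"
        by (intro J.corner_mem[OF less.prems(1)] less.IH[OF m] f)
      then show ?thesis using f(3) by (simp add: subunit_def)
    qed (rule maximal)
  qed
  have "cspan (\<Union>n. U n \<inter> I) \<subseteq> J"
    by (rule complex_vector.span_minimal[OF _ J.subspace]) (use units in blast)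
  then have "closure (cspan (\<Union>n. U n \<inter> I)) \<subseteq> J" by (rule closure_minimal[OF _ J.closed])
  then show ?thesis using I.mem_closure_span_units by blast
qed

end

theorem corollary7p3p2:
  fixes A B :: "'a::cstar_algebra set"
  assumes "AF_algebra B"
    and "regular_canonical_subalgebra A B"
  shows "principal_ideal_algebra A"
proof -
  obtain Bs l k e where B: "B = closure (\<Union>n. Bs n)" and mus: "matrix_unit_system Bs l k e"
    and D: "canonical_masa l k e \<subseteq> A" and AB: "A \<subseteq> B"
    using assms(2)
    unfolding regular_canonical_subalgebra_def regular_canonical_masa_def AF_chain_def by blast
  interpret nested_matrix_units Bs l k e by unfold_locales (rule mus)
  have diagA: "r \<in> A" if "r \<in> diag n" for r n
  proof -
    have "r \<in> cspan (diag n)" by (rule complex_vector.span_base[OF that])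
    then have "r \<in> (\<Union>n. cspan (diag n))" by (rule UN_I[OF UNIV_I])
    then have "r \<in> closure (\<Union>n. cspan (diag n))" by (rule subsetD[OF closure_subset])
    then show ?thesis using D unfolding canonical_masa_def diag_def by (rule subsetD[rotated])
  qed
  have bimodule: "diagonal_bimodule Bs l k e I" if "closed_ideal I A" for I
  proof
    show "closed I" "csubspace I" "I \<subseteq> closure (\<Union>n. Bs n)"
      using that AB B unfolding closed_ideal_def by auto
    fix r n x assume "r \<in> diag n" "x \<in> I"
    then have "r * x \<in> I \<and> x * r \<in> I"
      using that diagA[of r n] unfolding closed_ideal_def by blast
    then show "r * x \<in> I" "x * r \<in> I" by auto
  qed
  show ?thesis
    unfolding principal_ideal_algebra_def principal_closed_ideal_def
  proof (intro allI impI conjI)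
    fix I assume I: "closed_ideal I A"
    then show "closed_ideal I A" .
    interpret I: diagonal_bimodule Bs l k e I by (rule bimodule[OF I])
    have "I \<subseteq> J" if "closed_ideal J A \<and> I.generator \<in> J" for J
      using generator_generates[OF bimodule[OF I] bimodule] that by blast
    then show "\<exists>g\<in>A. g \<in> I \<and> (\<forall>J. closed_ideal J A \<and> g \<in> J \<longrightarrow> I \<subseteq> J)"
      using I.generator_mem I unfolding closed_ideal_def by blast
  qed
qed

end
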